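(* A divisible dimension group is $\mathbf{E}$-ultrasimplicial if and only if it is coherent, that is, every finitely generated ordered subgroup is finitely presented.
   Context: A partially ordered abelian group is an abelian group $G$ with a translation-invariant partial ordering; $G^+=\{x\in G\mid x\geq 0\}$. $G$ is directed if $G=G^++(-G^+)$; unperforated if $mx\geq 0$ implies $x\geq 0$ for all positive integers $m$ and $x\in G$; an interpolation group if for all $a_0,a_1,b_0,b_1\in G$ with $a_i\leq b_j$ for all $i,j\in\{0,1\}$, there is $x\in G$ with $a_i\leq x\leq b_j$ for all $i,j\in\{0,1\}$. A dimension group is a directed, unperforated interpolation group. $G$ is divisible if $mG=G$ for every positive integer $m$. An ordered subgroup of $G$ is a subgroup with the induced ordering. A partially ordered abelian group is simplicial if it is isomorphic, as an ordered group, to some $\mathbb{Z}^n$ ($n\geq 0$ an integer) with the componentwise ordering. $G$ is $\mathbf{E}$-ultrasimplicial if it is a directed union of simplicial (ordered) subgroups; equivalently, a direct limit of simplicial groups over a directed set, with transition maps that are positive embeddings (group homomorphisms $f$ with $f(x)\geq 0\iff x\geq 0$). A partially ordered abelian group $H$ is finitely presented if there exists a finite generating subset $\{g_1,\ldots,g_n\}$ of the group $H$ such that $\{\langle x_1,\ldots,x_n\rangle\in\mathbb{Z}^n\mid g_1x_1+\cdots+g_nx_n\geq 0\}$ is a finitely generated submonoid of $\mathbb{Z}^n$. *)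

theory Defs
  imports
    Complex_Main
    "HOL-Computational_Algebra.Group_Closure"
    "HOL-Library.Function_Algebras"
begin

text \<open>
  Partially ordered abelian groups are represented by their carriers: subgroups of a type of class
  \<^class>\<open>ordered_ab_group_add\<close>, with the induced ordering. Taking the carrier to be \<^term>\<open>UNIV\<close>
  covers every partially ordered abelian group. All notions below depend only on the carrier with
  its induced structure, not on the surrounding type.
\<close>

definition ordered_subgroup :: "'a::ordered_ab_group_add set \<Rightarrow> bool" where
  "ordered_subgroup G \<longleftrightarrow> 0 \<in> G \<and> (\<forall>x\<in>G. \<forall>y\<in>G. x - y \<in> G)"

definition int_mult :: "int \<Rightarrow> 'a::ab_group_add \<Rightarrow> 'a" where
  "int_mult m x = (if 0 \<le> m then \<Sum>i<nat m. x else - (\<Sum>i<nat (- m). x))"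

definition positive_cone :: "'a::ordered_ab_group_add set \<Rightarrow> 'a set" where
  "positive_cone G = {x \<in> G. 0 \<le> x}"

definition directed_group :: "'a::ordered_ab_group_add set \<Rightarrow> bool" where
  "directed_group G \<longleftrightarrow> (\<forall>x\<in>G. \<exists>a\<in>positive_cone G. \<exists>b\<in>positive_cone G. x = a + (- b))"

definition unperforated :: "'a::ordered_ab_group_add set \<Rightarrow> bool" where
  "unperforated G \<longleftrightarrow> (\<forall>m::int. \<forall>x\<in>G. 0 < m \<longrightarrow> 0 \<le> int_mult m x \<longrightarrow> 0 \<le> x)"

definition interpolation_group :: "'a::ordered_ab_group_add set \<Rightarrow> bool" where
  "interpolation_group G \<longleftrightarrow>
     (\<forall>a0\<in>G. \<forall>a1\<in>G. \<forall>b0\<in>G. \<forall>b1\<in>G.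
        a0 \<le> b0 \<and> a0 \<le> b1 \<and> a1 \<le> b0 \<and> a1 \<le> b1 \<longrightarrow>
        (\<exists>x\<in>G. a0 \<le> x \<and> a1 \<le> x \<and> x \<le> b0 \<and> x \<le> b1))"

definition dimension_group :: "'a::ordered_ab_group_add set \<Rightarrow> bool" where
  "dimension_group G \<longleftrightarrow>
     ordered_subgroup G \<and> directed_group G \<and> unperforated G \<and> interpolation_group G"

definition divisible_group :: "'a::ordered_ab_group_add set \<Rightarrow> bool" where
  "divisible_group G \<longleftrightarrow> (\<forall>m::int. 0 < m \<longrightarrow> int_mult m ` G = G)"

definition ordered_group_isomorphic ::
    "'a::ordered_ab_group_add set \<Rightarrow> 'b::ordered_ab_group_add set \<Rightarrow> bool" where
  "ordered_group_isomorphic G H \<longleftrightarrow>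
     (\<exists>f. bij_betw f G H \<and>
          (\<forall>x\<in>G. \<forall>y\<in>G. f (x + y) = f x + f y) \<and>
          (\<forall>x\<in>G. \<forall>y\<in>G. x \<le> y \<longleftrightarrow> f x \<le> f y))"

text \<open>
  The group $\mathbb{Z}^n$, encoded as the functions on \<^typ>\<open>nat\<close> vanishing from \<open>n\<close> on. Addition
  and ordering of functions are pointwise, hence componentwise on these vectors.
\<close>

definition int_vectors :: "nat \<Rightarrow> (nat \<Rightarrow> int) set" where
  "int_vectors n = {x. \<forall>i\<ge>n. x i = 0}"

definition simplicial :: "'a::ordered_ab_group_add set \<Rightarrow> bool" where
  "simplicial H \<longleftrightarrow> ordered_subgroup H \<and> (\<exists>n. ordered_group_isomorphic H (int_vectors n))"

definition E_ultrasimplicial :: "'a::ordered_ab_group_add set \<Rightarrow> bool" where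
  "E_ultrasimplicial G \<longleftrightarrow>
     (\<exists>\<H>. \<H> \<noteq> {} \<and> (\<forall>H\<in>\<H>. simplicial H) \<and>
          (\<forall>H\<in>\<H>. \<forall>K\<in>\<H>. \<exists>L\<in>\<H>. H \<subseteq> L \<and> K \<subseteq> L) \<and>
          G = \<Union>\<H>)"

definition submonoid :: "'a::comm_monoid_add set \<Rightarrow> bool" where
  "submonoid M \<longleftrightarrow> 0 \<in> M \<and> (\<forall>x\<in>M. \<forall>y\<in>M. x + y \<in> M)"

definition finitely_generated_submonoid :: "'a::comm_monoid_add set \<Rightarrow> bool" where
  "finitely_generated_submonoid M \<longleftrightarrow> (\<exists>B. finite B \<and> M = submonoid hull B)"

definition finitely_generated_group :: "'a::ordered_ab_group_add set \<Rightarrow> bool" where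
  "finitely_generated_group H \<longleftrightarrow> (\<exists>S. finite S \<and> H = group_closure S)"

definition finitely_presented :: "'a::ordered_ab_group_add set \<Rightarrow> bool" where
  "finitely_presented H \<longleftrightarrow>
     (\<exists>n. \<exists>g :: nat \<Rightarrow> 'a. H = group_closure (g ` {..<n}) \<and>
        finitely_generated_submonoid {x \<in> int_vectors n. 0 \<le> (\<Sum>i<n. int_mult (x i) (g i))})"

definition coherent :: "'a::ordered_ab_group_add set \<Rightarrow> bool" where
  "coherent G \<longleftrightarrow>
     (\<forall>H. ordered_subgroup H \<and> H \<subseteq> G \<and> finitely_generated_group H \<longrightarrow> finitely_presented H)"

end

theory Submission
  imports Defs
begin

text \<open>
  A finitely generated ordered subgroup of an E-ultrasimplicial group lies in a single copy of
  \<open>\<int>\<^sup>N\<close>, so its presentation cone is cut out by finitely many integral inequalities and is finitely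
  generated by Gordan's lemma.

  Conversely, let \<open>H\<close> be the image of \<open>\<phi> : \<int>\<^sup>n \<rightarrow> G\<close>, where the cone \<open>{x. 0 \<le> \<phi> x}\<close> has finitely many
  generators. Write \<open>\<phi> x = \<Sum>\<^sub>j t\<^sub>j(x) e\<^sub>j\<close> with additive \<open>t\<^sub>j\<close> and positive \<open>e\<^sub>j \<in> G\<close>. Applying Riesz
  refinement once for each generator of the cone, one arranges that all \<open>t\<^sub>j\<close> are nonnegative on the
  cone. When the number of summands is minimal, no \<open>t\<^sub>j\<close> is a nonnegative rational combination of the
  others, and Farkas' lemma shows that \<open>\<Sum> y\<^sub>j e\<^sub>j \<ge> 0\<close> holds only if all \<open>y\<^sub>j \<ge> 0\<close>. Thus the \<open>e\<^sub>j\<close>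
  span a simplicial subgroup of \<open>G\<close> containing \<open>H\<close>.
\<close>

subsection \<open>Integer multiples and subgroups\<close>

text \<open>Every abelian group is a module over the integers. Registering this makes the general
  scaling laws available for \<open>int_mult\<close>.\<close>

interpretation int_mult: module "int_mult :: int \<Rightarrow> 'a::ab_group_add \<Rightarrow> 'a"
proof -
  have nat: "int_mult (int n) x = (\<Sum>i<n. x)" for n and x :: 'a
    by (simp add: int_mult_def)
  have uminus: "int_mult (- m) x = - int_mult m x" for m and x :: 'a
    by (auto simp: int_mult_def)
  have nat_add: "int_mult (int m + int n) x = int_mult (int m) x + int_mult (int n) x"
    for m n and x :: 'a
    unfolding of_nat_add[symmetric] nat by (induction n) (simp_all add: algebra_simps)
  \<comment> \<open>The successor law serves both directions of the inductions over the integers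
    that prove \<open>add\<close> and \<open>assoc\<close>.\<close>
  have succ: "int_mult (m + 1) x = int_mult m x + x" for m and x :: 'a
  proof (cases m rule: int_cases)
    case (nonneg n)
    then show ?thesis using nat_add[of n 1 x] nat[of 1 x] by simp
  next
    case (neg n)
    have "int_mult (- int n) x = int_mult (- int (Suc n)) x + x"
      unfolding uminus nat by simp
    with neg show ?thesis by simp
  qed
  have add: "int_mult (a + b) x = int_mult a x + int_mult b x" for a b and x :: 'a
  proof (induction b rule: int_induct[where k = 0])
    case base
    show ?case by (simp add: int_mult_def)
  next
    case (step1 i)
    then show ?case using succ[of "a + i" x] succ[of i x] by (simp add: algebra_simps)
  next
    case (step2 i)
    then show ?case using succ[of "a + (i - 1)" x] succ[of "i - 1" x] by (simp add: algebra_simps)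
  qed
  have assoc: "int_mult a (int_mult b x) = int_mult (a * b) x" for a b and x :: 'a
  proof (induction a rule: int_induct[where k = 0])
    case base
    show ?case by (simp add: int_mult_def)
  next
    case (step1 i)
    then show ?case using add[of "i * b" b x] succ[of i "int_mult b x"] by (simp add: algebra_simps)
  next
    case (step2 i)
    then show ?case
      using add[of "(i - 1) * b" b x] succ[of "i - 1" "int_mult b x"] by (simp add: algebra_simps)
  qed
  show "module (int_mult :: int \<Rightarrow> 'a \<Rightarrow> 'a)"
    by unfold_locales
      (auto simp: add assoc, auto simp: int_mult_def sum.distrib)
qed

lemma (in additive) map_int_mult: "f (int_mult k x) = int_mult k (f x)"
  by (simp add: int_mult_def sum minus)

lemma int_mult_int [simp]: "int_mult k (x::int) = k * x"
  by (simp add: int_mult_def)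

lemma int_mult_nonneg:
  fixes x :: "'a::ordered_ab_group_add"
  assumes "0 \<le> k" "0 \<le> x"
  shows "0 \<le> int_mult k x"
  using assms by (simp add: int_mult_def sum_nonneg)

lemma ordered_subgroup_add:
  assumes "ordered_subgroup G" "x \<in> G" "y \<in> G"
  shows "x + y \<in> G"
proof -
  have "0 - y \<in> G"
    using assms unfolding ordered_subgroup_def by blast
  then have "x - (0 - y) \<in> G"
    using assms unfolding ordered_subgroup_def by blast
  then show ?thesis by simp
qed

lemma ordered_subgroup_uminus:
  assumes "ordered_subgroup G" "x \<in> G"
  shows "- x \<in> G"
  using assms unfolding ordered_subgroup_def by (metis diff_0)

lemma ordered_subgroup_diff:
  assumes "ordered_subgroup G" "x \<in> G" "y \<in> G"
  shows "x - y \<in> G"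
  using assms unfolding ordered_subgroup_def by blast

lemma ordered_subgroup_sum:
  assumes "ordered_subgroup G" "\<And>i. i \<in> I \<Longrightarrow> f i \<in> G"
  shows "sum f I \<in> G"
  using assms(2)
  by (induction I rule: infinite_finite_induct)
    (use assms(1) in \<open>auto simp: ordered_subgroup_def intro: ordered_subgroup_add[OF assms(1)]\<close>)

lemma ordered_subgroup_int_mult:
  assumes "ordered_subgroup G" "x \<in> G"
  shows "int_mult k x \<in> G"
  using assms
  by (auto simp: int_mult_def intro!: ordered_subgroup_sum ordered_subgroup_uminus)

lemma ordered_subgroup_group_closure: "ordered_subgroup (group_closure S)"
  by (auto simp: ordered_subgroup_def intro: group_closure.diff)

lemma group_closure_least:
  assumes "ordered_subgroup G" "S \<subseteq> G"
  shows "group_closure S \<subseteq> G"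
proof
  fix x assume "x \<in> group_closure S"
  then show "x \<in> G"
    by induction (use assms in \<open>auto simp: ordered_subgroup_def\<close>)
qed

lemma group_closure_image_eq:
  fixes g :: "nat \<Rightarrow> 'a::ordered_ab_group_add"
  shows "group_closure (g ` {..<n}) = range (\<lambda>x :: nat \<Rightarrow> int. \<Sum>i<n. int_mult (x i) (g i))"
    (is "?L = ?R")
proof
  have "ordered_subgroup ?R"
    unfolding ordered_subgroup_def
  proof (intro conjI ballI)
    show "0 \<in> ?R"
      by (rule range_eqI[of _ _ "\<lambda>_. 0"]) simp
  next
    fix u v assume "u \<in> ?R" "v \<in> ?R"
    then obtain x y where "u = (\<Sum>i<n. int_mult (x i) (g i))" "v = (\<Sum>i<n. int_mult (y i) (g i))"
      by auto
    then have "u - v = (\<Sum>i<n. int_mult (x i - y i) (g i))"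
      by (simp add: int_mult.scale_left_diff_distrib sum_subtractf)
    then show "u - v \<in> ?R"
      by (auto intro: range_eqI[of _ _ "\<lambda>i. x i - y i"])
  qed
  moreover have "g ` {..<n} \<subseteq> ?R"
  proof
    fix u assume "u \<in> g ` {..<n}"
    then obtain j where j: "j < n" "u = g j" by auto
    have "(\<Sum>i<n. int_mult (if i = j then 1 else 0) (g i)) = (\<Sum>i<n. if i = j then g i else 0)"
      by (rule sum.cong) auto
    also have "\<dots> = u" using j by simp
    finally show "u \<in> ?R"
      by (intro range_eqI[of _ _ "\<lambda>i. if i = j then 1 else 0"]) simp
  qed
  ultimately show "?L \<subseteq> ?R" by (rule group_closure_least)
next
  show "?R \<subseteq> ?L"
    by (auto intro!: ordered_subgroup_sum ordered_subgroup_int_mult ordered_subgroup_group_closure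
        intro: group_closure.base)
qed

lemma int_mult_nonneg_cancel:
  assumes "unperforated G" "x \<in> G" "0 < k" "0 \<le> int_mult k x"
  shows "0 \<le> x"
  using assms unfolding unperforated_def by blast

text \<open>Unperforation excludes torsion: it is applied to both \<open>x - y\<close> and
  \<open>y - x\<close>.\<close>

lemma int_mult_cancel:
  fixes G :: "'a::ordered_ab_group_add set"
  assumes "ordered_subgroup G" "unperforated G" "x \<in> G" "y \<in> G" "0 < k"
    "int_mult k x = int_mult k y"
  shows "x = y"
proof -
  have "0 \<le> int_mult k (x - y)" "0 \<le> int_mult k (y - x)"
    using assms(6) by (simp_all add: int_mult.scale_right_diff_distrib)
  then have "0 \<le> x - y" "0 \<le> y - x"
    using assms int_mult_nonneg_cancel[of G _ k] ordered_subgroup_diff[of G] by blast+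
  then show ?thesis by simp
qed

text \<open>The two hypotheses make the combination map preserve and reflect the order. By
  antisymmetry this already includes linear independence of the \<open>e j\<close>.\<close>

lemma simplicial_group_closure:
  fixes e :: "nat \<Rightarrow> 'a::ordered_ab_group_add"
  assumes "\<And>j. j < m \<Longrightarrow> 0 \<le> e j"
    "\<And>y j. 0 \<le> (\<Sum>i<m. int_mult (y i) (e i)) \<Longrightarrow> j < m \<Longrightarrow> 0 \<le> y j"
  shows "simplicial (group_closure (e ` {..<m}))"
proof -
  define \<psi> where "\<psi> y = (\<Sum>i<m. int_mult (y i) (e i))" for y :: "nat \<Rightarrow> int"
  have add: "\<psi> (y + z) = \<psi> y + \<psi> z" for y z
    by (simp add: \<psi>_def int_mult.scale_left_distrib sum.distrib)
  have le: "\<psi> y \<le> \<psi> z \<longleftrightarrow> y \<le> z" if "y \<in> int_vectors m" "z \<in> int_vectors m" for y z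
  proof
    assume "\<psi> y \<le> \<psi> z"
    then have "0 \<le> (\<Sum>i<m. int_mult (z i - y i) (e i))"
      by (simp add: \<psi>_def int_mult.scale_left_diff_distrib sum_subtractf)
    then have "y i \<le> z i" if "i < m" for i
      using assms(2)[of "\<lambda>i. z i - y i" i] that by simp
    then show "y \<le> z"
      using that by (auto simp: le_fun_def int_vectors_def) (metis linorder_not_less order_refl)
  next
    assume "y \<le> z"
    then have "0 \<le> (\<Sum>i<m. int_mult (z i - y i) (e i))"
      using assms(1) by (intro sum_nonneg int_mult_nonneg) (auto simp: le_fun_def)
    then show "\<psi> y \<le> \<psi> z"
      by (simp add: \<psi>_def int_mult.scale_left_diff_distrib sum_subtractf)
  qed
  have inj: "inj_on \<psi> (int_vectors m)"
    by (rule inj_onI) (metis le order.refl order.antisym)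
  have image: "group_closure (e ` {..<m}) = \<psi> ` int_vectors m"
  proof -
    \<comment> \<open>Coordinates from \<open>m\<close> on do not affect \<open>\<psi>\<close>, so
      \<open>y\<close> may be truncated.\<close>
    have "\<psi> y \<in> \<psi> ` int_vectors m" for y
      by (rule image_eqI[of _ _ "\<lambda>i. if i < m then y i else 0"])
        (auto simp: \<psi>_def int_vectors_def intro!: sum.cong)
    then show ?thesis
      unfolding group_closure_image_eq \<psi>_def[symmetric] by auto
  qed
  with inj have bij: "bij_betw \<psi> (int_vectors m) (group_closure (e ` {..<m}))"
    by (simp add: bij_betw_def)
  let ?f = "inv_into (int_vectors m) \<psi>"
  have f: "?f (\<psi> y) = y" if "y \<in> int_vectors m" for y
    using inj that by simp
  have plus: "y + z \<in> int_vectors m" if "y \<in> int_vectors m" "z \<in> int_vectors m" for y z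
    using that by (simp add: int_vectors_def)
  have "ordered_group_isomorphic (group_closure (e ` {..<m})) (int_vectors m)"
    unfolding ordered_group_isomorphic_def
  proof (intro exI[of _ ?f] conjI ballI)
    show "bij_betw ?f (group_closure (e ` {..<m})) (int_vectors m)"
      using bij by (rule bij_betw_inv_into)
  next
    fix u v assume "u \<in> group_closure (e ` {..<m})" "v \<in> group_closure (e ` {..<m})"
    then obtain y z where yz: "y \<in> int_vectors m" "u = \<psi> y" "z \<in> int_vectors m" "v = \<psi> z"
      unfolding image by blast
    then show "?f (u + v) = ?f u + ?f v"
      by (simp add: f plus flip: add)
    show "u \<le> v \<longleftrightarrow> ?f u \<le> ?f v"
      using yz by (simp add: f le)
  qed
  then show ?thesis
    by (auto simp: simplicial_def ordered_subgroup_group_closure)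
qed

subsection \<open>Gordan's lemma\<close>

text \<open>Some subsequence is monotone. If it is decreasing, it stays constant once it has reached
  its least value, so that tail is nondecreasing too.\<close>

lemma nat_seq_incseq_subseq:
  fixes s :: "nat \<Rightarrow> nat"
  obtains r where "strict_mono r" "incseq (\<lambda>n. s (r n))"
proof -
  obtain r where r: "strict_mono r" "monoseq (\<lambda>n. s (r n))"
    using seq_monosub by blast
  show thesis
  proof (cases "incseq (\<lambda>n. s (r n))")
    case True
    with r that show thesis by blast
  next
    case False
    with r have dec: "decseq (\<lambda>n. s (r n))" by (auto simp: monoseq_iff)
    define m where "m = (LEAST m. \<exists>k. s (r k) = m)"
    have "\<exists>k. s (r k) = m" unfolding m_def by (rule LeastI_ex) blast
    then obtain k where k: "s (r k) = m" by blast
    have ge: "m \<le> s (r n)" for n unfolding m_def by (rule Least_le) blast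
    have "s (r (k + n)) = m" for n
      using decseqD[OF dec, of k "k + n"] ge[of "k + n"] k by simp
    then have "incseq (\<lambda>n. s ((\<lambda>n. r (k + n)) n))" by (simp add: incseq_def)
    moreover have "strict_mono (\<lambda>n. r (k + n))" using r(1) by (simp add: strict_mono_def)
    ultimately show thesis using that by blast
  qed
qed

text \<open>Subsequences are extracted for one coordinate after the other; a nondecreasing
  coordinate stays so under further thinning.\<close>

lemma dickson_subseq:
  fixes s :: "nat \<Rightarrow> 'k \<Rightarrow> nat"
  assumes "finite K"
  shows "\<exists>r. strict_mono r \<and> (\<forall>k\<in>K. incseq (\<lambda>n. s (r n) k))"
  using assms
proof (induction K rule: finite_induct)
  case empty
  show ?case using strict_mono_id by blast
next
  case (insert a K)
  then obtain r where r: "strict_mono r" "\<forall>k\<in>K. incseq (\<lambda>n. s (r n) k)" by blast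
  obtain q where q: "strict_mono q" "incseq (\<lambda>n. s (r (q n)) a)"
    using nat_seq_incseq_subseq[of "\<lambda>n. s (r n) a"] by blast
  have "incseq (\<lambda>n. s (r (q n)) k)" if "k \<in> K" for k
    using r(2) that q(1) by (auto simp: incseq_def strict_mono_less_eq)
  moreover have "strict_mono (\<lambda>n. r (q n))" using strict_mono_o[OF r(1) q(1)] by (simp add: comp_def)
  ultimately show ?case using q(2) by (intro exI[of _ "\<lambda>n. r (q n)"]) auto
qed

text \<open>Dickson's lemma for antichains: an injective sequence in an infinite \<open>B\<close>
  would have a subsequence nondecreasing in every coordinate, hence two distinct comparable
  members.\<close>

lemma dickson_finite:
  fixes \<mu> :: "'a \<Rightarrow> 'k \<Rightarrow> nat"
  assumes "finite K" "\<And>x y. x \<in> B \<Longrightarrow> y \<in> B \<Longrightarrow> (\<And>k. k \<in> K \<Longrightarrow> \<mu> x k \<le> \<mu> y k) \<Longrightarrow> x = y"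
  shows "finite B"
proof (rule ccontr)
  assume "infinite B"
  then obtain s :: "nat \<Rightarrow> 'a" where s: "inj s" "range s \<subseteq> B"
    using infinite_countable_subset by blast
  obtain r where r: "strict_mono r" "\<forall>k\<in>K. incseq (\<lambda>n. \<mu> (s (r n)) k)"
    using dickson_subseq[OF assms(1), of "\<lambda>n. \<mu> (s n)"] by blast
  have "s (r 0) = s (r 1)"
    using r(2) s(2) by (intro assms(2)) (auto simp: incseq_def)
  then have "r 0 = r 1" using s(1) by (simp add: inj_eq)
  moreover have "r 0 < r 1" using r(1) by (simp add: strict_mono_def)
  ultimately show False by simp
qed

text \<open>The indecomposable elements, i.e. those minimal for the sizes of the positive parts, the
  negative parts and the values \<open>\<alpha>\<^sub>k x\<close>, generate; by Dickson's lemma there are finitely many.\<close>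
lemma gordan:
  fixes \<alpha> :: "'k \<Rightarrow> (nat \<Rightarrow> int) \<Rightarrow> int"
  assumes "finite K" and add: "\<And>k. k \<in> K \<Longrightarrow> additive (\<alpha> k)"
  shows "finitely_generated_submonoid {x \<in> int_vectors n. \<forall>k\<in>K. 0 \<le> \<alpha> k x}"
proof -
  define C where "C = {x \<in> int_vectors n. \<forall>k\<in>K. 0 \<le> \<alpha> k x}"
  \<comment> \<open>If \<open>dom y x\<close>, then \<open>x = y + (x - y)\<close> involves no
    cancellation in any coordinate, and for \<open>x\<close> and \<open>y\<close> in
    \<open>C\<close> the difference stays in \<open>C\<close>.\<close>
  define dom where "dom x y \<longleftrightarrow> (\<forall>i<n. nat (x i) \<le> nat (y i) \<and> nat (- x i) \<le> nat (- y i)) \<and>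
      (\<forall>k\<in>K. \<alpha> k x \<le> \<alpha> k y)" for x y :: "nat \<Rightarrow> int"
  define B where "B = {x \<in> C - {0}. \<forall>y \<in> C - {0}. dom y x \<longrightarrow> y = x}"
  define size where "size x = (\<Sum>i<n. nat \<bar>x i\<bar>)" for x :: "nat \<Rightarrow> int"
  have size_pos: "0 < size x" if x: "x \<in> C - {0}" for x
  proof -
    have "\<exists>i<n. x i \<noteq> 0"
    proof (rule ccontr)
      assume "\<not> ?thesis"
      then have "x = 0"
        using x by (auto simp: C_def int_vectors_def fun_eq_iff) (metis linorder_not_less)
      with x show False by simp
    qed
    then show ?thesis
      unfolding size_def by (auto intro: sum_pos2)
  qed
  have "submonoid C"
    using add by (auto simp: submonoid_def C_def int_vectors_def additive.add additive.zero)
  have "finite B"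
  proof (rule dickson_finite)
    \<comment> \<open>Splitting coordinates into positive and negative parts encodes signed vectors
      by naturals. On \<open>C\<close> the values of \<open>\<alpha>\<close> are nonnegative, so
      \<open>nat\<close> loses nothing.\<close>
    let ?K = "Inl ` (UNIV \<times> {..<n}) \<union> Inr ` K :: ((bool \<times> nat) + 'k) set"
    let ?\<mu> = "\<lambda>x. case_sum (\<lambda>(s, i). if s then nat (x i) else nat (- x i)) (\<lambda>k. nat (\<alpha> k x))"
    show "finite ?K" using assms(1) by simp
    fix x y assume xy: "x \<in> B" "y \<in> B" and le: "\<And>k. k \<in> ?K \<Longrightarrow> ?\<mu> x k \<le> ?\<mu> y k"
    have "nat (x i) \<le> nat (y i)" "nat (- x i) \<le> nat (- y i)" if "i < n" for i
      using le[of "Inl (True, i)"] le[of "Inl (False, i)"] that by auto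
    moreover have "\<alpha> k x \<le> \<alpha> k y" if "k \<in> K" for k
      using le[of "Inr k"] that xy by (auto simp: B_def C_def)
    ultimately have "dom x y" by (simp add: dom_def)
    with xy show "x = y" by (auto simp: B_def)
  qed
  moreover have "C = submonoid hull B"
  proof
    show "submonoid hull B \<subseteq> C"
      using \<open>submonoid C\<close> by (intro hull_minimal) (auto simp: B_def)
    have hull: "submonoid (submonoid hull B)"
      by (rule hull_in) (auto simp: submonoid_def)
    show "C \<subseteq> submonoid hull B"
    proof
      fix x assume "x \<in> C"
      then show "x \<in> submonoid hull B"
      proof (induction "size x" arbitrary: x rule: less_induct)
        case less
        consider "x = 0" | "x \<in> B" | "x \<in> C - {0}" "x \<notin> B" using less.prems by blast
        then show ?case
        proof cases
          case 1
          then show ?thesis using hull by (simp add: submonoid_def)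
        next
          case 2
          then show ?thesis by (rule hull_inc)
        next
          case 3
          then obtain y where y: "y \<in> C - {0}" "dom y x" "y \<noteq> x" by (auto simp: B_def)
          have z: "x - y \<in> C - {0}"
            using 3 y add by (auto simp: C_def int_vectors_def dom_def additive.diff)
          \<comment> \<open>Without cancellation the sizes add up; as both summands are nonzero,
            both are strictly smaller than \<open>x\<close> and the induction applies.\<close>
          have "nat \<bar>x i\<bar> = nat \<bar>y i\<bar> + nat \<bar>(x - y) i\<bar>" if "i < n" for i
            using y(2) that unfolding dom_def by (auto simp: nat_le_iff split: if_splits)
          then have "size x = size y + size (x - y)"
            by (simp add: size_def sum.distrib)
          then have "size y < size x" "size (x - y) < size x"
            using size_pos[OF y(1)] size_pos[OF z] by auto
          then have "y \<in> submonoid hull B" "x - y \<in> submonoid hull B"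
            using less.hyps y z by auto
          then have "y + (x - y) \<in> submonoid hull B"
            using hull unfolding submonoid_def by blast
          then show ?thesis by simp
        qed
      qed
    qed
  qed
  ultimately show ?thesis
    unfolding C_def finitely_generated_submonoid_def by blast
qed

section \<open>From E-ultrasimplicial to coherent\<close>

text \<open>The coordinates of \<open>L\<close> as a copy of Z^N, pulled back along
  \<open>\<phi>\<close>, cut out the presentation cone by \<open>N\<close> additive inequalities, as
  \<open>gordan\<close> requires.\<close>

lemma finitely_presented_of_simplicial:
  assumes L: "simplicial L" and H: "ordered_subgroup H" "finitely_generated_group H" "H \<subseteq> L"
  shows "finitely_presented H"
proof -
  obtain S where S: "finite S" "H = group_closure S"
    using H(2) by (auto simp: finitely_generated_group_def)
  obtain n and g :: "nat \<Rightarrow> 'a" where g: "S = g ` {..<n}"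
    using finite_imp_nat_seg_image_inj_on[OF S(1)] by (auto simp: lessThan_def)
  obtain N f where sub: "ordered_subgroup L" and f: "bij_betw f L (int_vectors N)"
    "\<And>x y. x \<in> L \<Longrightarrow> y \<in> L \<Longrightarrow> f (x + y) = f x + f y"
    "\<And>x y. x \<in> L \<Longrightarrow> y \<in> L \<Longrightarrow> x \<le> y \<longleftrightarrow> f x \<le> f y"
    using L unfolding simplicial_def ordered_group_isomorphic_def by auto
  define \<phi> where "\<phi> x = (\<Sum>i<n. int_mult (x i) (g i))" for x :: "nat \<Rightarrow> int"
  have \<phi>_add: "\<phi> (x + y) = \<phi> x + \<phi> y" for x y
    by (simp add: \<phi>_def int_mult.scale_left_distrib sum.distrib)
  have range: "H = range \<phi>"
    unfolding S(2) g group_closure_image_eq \<phi>_def ..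
  then have mem: "\<phi> x \<in> L" for x using H(3) by blast
  have zero: "0 \<in> L" using sub by (simp add: ordered_subgroup_def)
  have f0: "f 0 = 0" using f(2)[OF zero zero] by simp
  have nonneg: "0 \<le> \<phi> x \<longleftrightarrow> (\<forall>k\<in>{..<N}. 0 \<le> f (\<phi> x) k)" for x
  proof -
    have "f (\<phi> x) \<in> int_vectors N" using f(1) mem by (auto simp: bij_betw_def)
    then have "(\<forall>k\<in>{..<N}. 0 \<le> f (\<phi> x) k) \<longleftrightarrow> 0 \<le> f (\<phi> x)"
      by (auto simp: le_fun_def int_vectors_def) (metis lessThan_iff linorder_not_less order_refl)
    then show ?thesis using f(3)[OF zero mem] f0 by simp
  qed
  have "finitely_generated_submonoid {x \<in> int_vectors n. \<forall>k\<in>{..<N}. 0 \<le> f (\<phi> x) k}"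
    by (rule gordan) (simp_all add: additive_def \<phi>_add f(2) mem)
  then have "finitely_generated_submonoid {x \<in> int_vectors n. 0 \<le> (\<Sum>i<n. int_mult (x i) (g i))}"
    unfolding \<phi>_def[symmetric] nonneg .
  then show ?thesis
    unfolding finitely_presented_def S(2) g by (intro exI conjI) (rule refl)
qed

lemma E_ultrasimplicial_imp_coherent:
  assumes "E_ultrasimplicial G"
  shows "coherent G"
  unfolding coherent_def
proof (intro allI impI)
  fix H assume H: "ordered_subgroup H \<and> H \<subseteq> G \<and> finitely_generated_group H"
  obtain \<H> where \<H>: "\<H> \<noteq> {}" "\<forall>L\<in>\<H>. simplicial L"
    "\<forall>L\<in>\<H>. \<forall>K\<in>\<H>. \<exists>M\<in>\<H>. L \<subseteq> M \<and> K \<subseteq> M" "G = \<Union>\<H>"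
    using assms unfolding E_ultrasimplicial_def by (elim exE conjE)
  obtain S where S: "finite S" "H = group_closure S"
    using H by (auto simp: finitely_generated_group_def)
  have "S \<subseteq> G" using S H by (blast intro: group_closure.base)
  \<comment> \<open>Directedness of the union collects the finitely many generators in one
    member.\<close>
  with S(1) have "\<exists>L\<in>\<H>. S \<subseteq> L"
  proof (induction S rule: finite_induct)
    case empty
    then show ?case using \<H>(1) by blast
  next
    case (insert s S)
    then obtain L K where "L \<in> \<H>" "S \<subseteq> L" "K \<in> \<H>" "s \<in> K" using \<H>(4) by auto
    moreover from this obtain M where "M \<in> \<H>" "L \<subseteq> M" "K \<subseteq> M" using \<H>(3) by meson
    ultimately show ?case by blast
  qed
  then obtain L where L: "L \<in> \<H>" "S \<subseteq> L" by blast
  then have "H \<subseteq> L"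
    unfolding S(2) using \<H>(2) by (intro group_closure_least) (auto simp: simplicial_def)
  with H L \<H>(2) show "finitely_presented H"
    by (blast intro: finitely_presented_of_simplicial)
qed

subsection \<open>Farkas' lemma\<close>

text \<open>Induction on the number of functionals, eliminating one at a time. The factor
  \<open>N\<close> clears denominators, so that all coefficients are integers.\<close>

lemma farkas_additive:
  fixes t :: "'i \<Rightarrow> 'b::ab_group_add \<Rightarrow> int"
  assumes "finite J" "\<And>j. j \<in> J \<Longrightarrow> additive (t j)" "additive \<gamma>"
    "\<And>x. (\<And>j. j \<in> J \<Longrightarrow> 0 \<le> t j x) \<Longrightarrow> 0 \<le> \<gamma> x"
  shows "\<exists>N>0. \<exists>n. (\<forall>j\<in>J. 0 \<le> n j) \<and> (\<forall>x. N * \<gamma> x = (\<Sum>j\<in>J. n j * t j x))"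
  using assms
proof (induction J arbitrary: t \<gamma> rule: finite_induct)
  case empty
  interpret additive \<gamma> by (fact empty)
  have "\<gamma> x = 0" for x
    using empty(3)[of x] empty(3)[of "- x"] by (simp add: minus)
  then show ?case by (intro exI[of _ 1]) simp
next
  case (insert m J)
  show ?case
  proof (cases "\<forall>x. (\<forall>j\<in>J. 0 \<le> t j x) \<longrightarrow> 0 \<le> \<gamma> x")
    case True
    then have "\<exists>N>0. \<exists>n. (\<forall>j\<in>J. 0 \<le> n j) \<and> (\<forall>x. N * \<gamma> x = (\<Sum>j\<in>J. n j * t j x))"
      using insert.prems by (intro insert.IH) auto
    then obtain N n where "N > 0" "\<forall>j\<in>J. 0 \<le> n j" "\<forall>x. N * \<gamma> x = (\<Sum>j\<in>J. n j * t j x)"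
      by blast
    then show ?thesis
      using insert.hyps
      by (intro exI[of _ N] conjI exI[of _ "n(m := 0)"]) (auto intro!: sum.cong)
  next
    case False
    then obtain x0 where x0: "\<And>j. j \<in> J \<Longrightarrow> 0 \<le> t j x0" "\<gamma> x0 < 0"
      by force
    then have m: "t m x0 < 0"
      using insert.prems(3)[of x0] by fastforce
    define d where "d = - t m x0"
    have d: "d > 0" using m by (simp add: d_def)
    \<comment> \<open>These are \<open>t j\<close> and \<open>\<gamma>\<close> evaluated at
      \<open>int_mult d x + int_mult (t m x) x0\<close>, a multiple of the projection along
      \<open>x0\<close> to the kernel of \<open>t m\<close>. There the constraint from
      \<open>m\<close> holds trivially.\<close>
    define t' where "t' j x = d * t j x + t j x0 * t m x" for j x
    define \<gamma>' where "\<gamma>' x = d * \<gamma> x + \<gamma> x0 * t m x" for x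
    have "\<exists>N>0. \<exists>n. (\<forall>j\<in>J. 0 \<le> n j) \<and> (\<forall>x. N * \<gamma>' x = (\<Sum>j\<in>J. n j * t' j x))"
    proof (rule insert.IH)
      show "additive (t' j)" if "j \<in> J" for j
        using insert.prems(1)[of j] insert.prems(1)[of m] that
        by (auto simp: t'_def additive_def algebra_simps)
      show "additive \<gamma>'"
        using insert.prems(1)[of m] insert.prems(2)
        by (auto simp: \<gamma>'_def additive_def algebra_simps)
      show "0 \<le> \<gamma>' x" if x: "\<And>j. j \<in> J \<Longrightarrow> 0 \<le> t' j x" for x
      proof -
        define y where "y = int_mult d x + int_mult (t m x) x0"
        have y: "f y = d * f x + t m x * f x0" if "additive f" for f :: "'b \<Rightarrow> int"
          using that by (simp add: y_def additive.add additive.map_int_mult)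
        have "0 \<le> t j y" if "j \<in> insert m J" for j
          using that x[of j] y[of "t j"] insert.prems(1)[of j]
          by (auto simp: t'_def d_def algebra_simps)
        then have "0 \<le> \<gamma> y" using insert.prems(3) by blast
        then show ?thesis using y[of \<gamma>] insert.prems(2) by (simp add: \<gamma>'_def algebra_simps)
      qed
    qed
    then obtain N n where N: "N > 0" "\<forall>j\<in>J. 0 \<le> n j" "\<And>x. N * \<gamma>' x = (\<Sum>j\<in>J. n j * t' j x)"
      by blast
    \<comment> \<open>This is the coefficient of \<open>t m\<close> when the identity for
      \<open>\<gamma>'\<close> is expanded and solved for \<open>\<gamma>\<close>; the choice of
      \<open>x0\<close> makes it nonnegative.\<close>
    define c where "c = (\<Sum>j\<in>J. n j * t j x0) - N * \<gamma> x0"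
    have "0 \<le> (\<Sum>j\<in>J. n j * t j x0)"
      using N x0 by (intro sum_nonneg) auto
    moreover have "N * \<gamma> x0 < 0"
      using N x0 by (simp add: mult_pos_neg)
    ultimately have c: "0 \<le> c" by (simp add: c_def)
    have "N * d * \<gamma> x = c * t m x + (\<Sum>j\<in>J. n j * d * t j x)" for x
    proof -
      have "(\<Sum>j\<in>J. n j * t' j x) = (\<Sum>j\<in>J. n j * d * t j x) + (\<Sum>j\<in>J. n j * t j x0) * t m x"
        by (simp add: t'_def algebra_simps sum.distrib sum_distrib_left)
      then show ?thesis
        using N(3)[of x] by (simp add: \<gamma>'_def c_def algebra_simps)
    qed
    then show ?thesis
      using insert.hyps N c d
      by (intro exI[of _ "N * d"] conjI exI[of _ "(\<lambda>j. n j * d)(m := c)"])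
        (auto intro!: sum.cong)
  qed
qed

subsection \<open>Positive factorizations\<close>

text \<open>A factorization of \<open>\<phi>\<close> through the free group on \<open>J\<close>: the
  \<open>t j\<close> are the coordinates of the first map, and the \<open>e j\<close> are the images
  of the unit vectors under the second, positive map. Positivity of the first map is achieved later
  by refinement.\<close>

definition positive_factorization ::
    "'a::ordered_ab_group_add set \<Rightarrow> ('b::ab_group_add \<Rightarrow> 'a) \<Rightarrow> 'i set \<Rightarrow> ('i \<Rightarrow> 'b \<Rightarrow> int) \<Rightarrow> ('i \<Rightarrow> 'a) \<Rightarrow> bool"
  where
  "positive_factorization G \<phi> J t e \<longleftrightarrow>
     finite J \<and> (\<forall>j\<in>J. additive (t j)) \<and> (\<forall>j\<in>J. e j \<in> G \<and> 0 \<le> e j) \<and>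
     (\<forall>x. \<phi> x = (\<Sum>j\<in>J. int_mult (t j x) (e j)))"

text \<open>Refinement yields pairs as indices and removal leaves gaps; renumbering returns to
  initial segments, whose lengths can be compared.\<close>

lemma positive_factorization_reindex:
  assumes "positive_factorization G \<phi> J t e"
  obtains h where "bij_betw h {..<card J} J"
    "positive_factorization G \<phi> {..<card J} (t \<circ> h) (e \<circ> h)"
proof -
  have "finite J" using assms by (simp add: positive_factorization_def)
  then obtain h where h: "bij_betw h {..<card J} J"
    using ex_bij_betw_nat_finite[of J] by (auto simp: atLeast0LessThan)
  then have "h i \<in> J" if "i < card J" for i
    using that by (auto simp: bij_betw_def)
  then have "positive_factorization G \<phi> {..<card J} (t \<circ> h) (e \<circ> h)"
    using assms sum.reindex_bij_betw[OF h, of "\<lambda>j. int_mult (t j _) (e j)"]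
    by (auto simp: positive_factorization_def)
  with h that show thesis by blast
qed

section \<open>Division and Riesz decomposition\<close>

locale divisible_dimension_group =
  fixes G :: "'a::ordered_ab_group_add set"
  assumes dimension: "dimension_group G" and divisible: "divisible_group G"
begin

lemma subgroup: "ordered_subgroup G"
  and directed: "directed_group G"
  and unperf: "unperforated G"
  and interpolation: "interpolation_group G"
  using dimension by (auto simp: dimension_group_def)

lemmas sum_mem = ordered_subgroup_sum[OF subgroup]
lemmas diff_mem = ordered_subgroup_diff[OF subgroup]
lemmas add_mem = ordered_subgroup_add[OF subgroup]
lemmas int_mult_mem = ordered_subgroup_int_mult[OF subgroup]

lemma zero_mem: "0 \<in> G"
  using subgroup by (simp add: ordered_subgroup_def)

text \<open>Divisibility gives the quotient and unperforation makes it positive.\<close>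

lemma divide_positive:
  assumes "x \<in> G" "0 \<le> x" "0 < k"
  obtains y where "y \<in> G" "0 \<le> y" "int_mult k y = x"
proof -
  have "x \<in> int_mult k ` G"
    using divisible assms by (simp add: divisible_group_def)
  then obtain y where "y \<in> G" "x = int_mult k y" by blast
  with that assms int_mult_nonneg_cancel[OF unperf] show thesis by blast
qed

lemma riesz_decomposition:
  assumes "finite J" "\<And>j. j \<in> J \<Longrightarrow> g j \<in> G \<and> 0 \<le> g j" "f \<in> G" "0 \<le> f" "f \<le> sum g J"
  shows "\<exists>c. (\<forall>j\<in>J. c j \<in> G \<and> 0 \<le> c j \<and> c j \<le> g j) \<and> f = sum c J"
  using assms
proof (induction J arbitrary: f rule: finite_induct)
  case empty
  then show ?case by simp
next
  case (insert k J)
  have gs: "sum g J \<in> G" "0 \<le> sum g J"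
    using insert.prems by (auto intro: sum_mem sum_nonneg)
  \<comment> \<open>The share of \<open>k\<close> is interpolated between \<open>0\<close>,
    \<open>f - sum g J\<close> and \<open>f\<close>, \<open>g k\<close>; the lower bounds ensure
    that the remainder \<open>f - x\<close> still fits below \<open>sum g J\<close>.\<close>
  have "\<exists>x\<in>G. 0 \<le> x \<and> f - sum g J \<le> x \<and> x \<le> f \<and> x \<le> g k"
  proof -
    have "f - sum g J \<in> G" using insert.prems gs by (intro diff_mem)
    moreover have "g k \<in> G" "0 \<le> g k" using insert.prems by auto
    moreover have "f - sum g J \<le> f" "f - sum g J \<le> g k"
      using insert.prems insert.hyps gs by (auto simp: algebra_simps)
    ultimately show ?thesis
      using interpolation zero_mem insert.prems unfolding interpolation_group_def by blast
  qed
  then obtain x where x: "x \<in> G" "0 \<le> x" "f - sum g J \<le> x" "x \<le> f" "x \<le> g k" by blast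
  have "\<exists>c. (\<forall>j\<in>J. c j \<in> G \<and> 0 \<le> c j \<and> c j \<le> g j) \<and> f - x = sum c J"
    using x insert.prems by (intro insert.IH) (auto intro: diff_mem simp: algebra_simps)
  then obtain c where "\<forall>j\<in>J. c j \<in> G \<and> 0 \<le> c j \<and> c j \<le> g j" "f - x = sum c J" by blast
  moreover have "sum (c(k := x)) J = sum c J"
    using insert.hyps by (intro sum.cong) auto
  ultimately show ?case
    using x insert.hyps by (intro exI[of _ "c(k := x)"]) (auto simp: algebra_simps)
qed

text \<open>Row by row: \<open>f k\<close> is decomposed below \<open>g\<close>, and the other rows
  are refined against what is left of \<open>g\<close>. The inequality leaves a slack in each
  column.\<close>

lemma riesz_refinement:
  assumes "finite I" "finite J"
    "\<And>i. i \<in> I \<Longrightarrow> f i \<in> G \<and> 0 \<le> f i" "\<And>j. j \<in> J \<Longrightarrow> g j \<in> G \<and> 0 \<le> g j"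
    "sum f I \<le> sum g J"
  shows "\<exists>c. (\<forall>i\<in>I. \<forall>j\<in>J. c i j \<in> G \<and> 0 \<le> c i j) \<and> (\<forall>i\<in>I. f i = (\<Sum>j\<in>J. c i j)) \<and>
     (\<forall>j\<in>J. (\<Sum>i\<in>I. c i j) \<le> g j)"
  using assms(1,3-)
proof (induction I arbitrary: g rule: finite_induct)
  case empty
  then show ?case by simp
next
  case (insert k I)
  have "0 \<le> sum f I"
    using insert.prems(1) by (intro sum_nonneg) auto
  then have "f k \<le> f k + sum f I" by simp
  also have "\<dots> \<le> sum g J" using insert.hyps insert.prems(3) by simp
  finally obtain d where d: "\<forall>j\<in>J. d j \<in> G \<and> 0 \<le> d j \<and> d j \<le> g j" "f k = sum d J"
    using riesz_decomposition[OF assms(2), of g "f k"] insert.prems(1,2) by auto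
  have "\<exists>c. (\<forall>i\<in>I. \<forall>j\<in>J. c i j \<in> G \<and> 0 \<le> c i j) \<and> (\<forall>i\<in>I. f i = (\<Sum>j\<in>J. c i j)) \<and>
     (\<forall>j\<in>J. (\<Sum>i\<in>I. c i j) \<le> g j - d j)"
  proof (rule insert.IH)
    show "f i \<in> G \<and> 0 \<le> f i" if "i \<in> I" for i using that insert.prems(1) by blast
    show "g j - d j \<in> G \<and> 0 \<le> g j - d j" if "j \<in> J" for j
      using that insert.prems(2)[of j] d(1) by (auto intro: diff_mem)
    have "f k + sum f I \<le> sum g J" using insert.hyps insert.prems(3) by simp
    then show "sum f I \<le> (\<Sum>j\<in>J. g j - d j)"
      by (simp add: sum_subtractf d(2)[symmetric] algebra_simps)
  qed
  then obtain c where c: "\<forall>i\<in>I. \<forall>j\<in>J. c i j \<in> G \<and> 0 \<le> c i j" "\<forall>i\<in>I. f i = (\<Sum>j\<in>J. c i j)"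
    "\<forall>j\<in>J. (\<Sum>i\<in>I. c i j) \<le> g j - d j" by blast
  define c' where "c' = c(k := d)"
  have c': "c' k = d" "\<And>i. i \<in> I \<Longrightarrow> c' i = c i"
    using insert.hyps by (auto simp: c'_def)
  have "\<forall>i\<in>insert k I. \<forall>j\<in>J. c' i j \<in> G \<and> 0 \<le> c' i j"
    using c(1) d(1) by (simp add: c')
  moreover have "\<forall>i\<in>insert k I. f i = (\<Sum>j\<in>J. c' i j)"
    using c(2) d(2) by (simp add: c')
  moreover have "\<forall>j\<in>J. (\<Sum>i\<in>insert k I. c' i j) \<le> g j"
    using c(3) insert.hyps by (simp add: c' le_diff_eq add.commute)
  ultimately show ?case by blast
qed

text \<open>With \<open>y\<^sub>j = t\<^sub>j(b)\<close>, the elements \<open>|y\<^sub>i| e\<^sub>i\<close> for \<open>y\<^sub>i < 0\<close> are refined against the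
  \<open>y\<^sub>j e\<^sub>j\<close> for \<open>y\<^sub>j > 0\<close>. Dividing the resulting pieces by the common multiple \<open>M\<close> of the \<open>|y\<^sub>j|\<close>
  keeps all coefficients integral.\<close>
lemma positive_factorization_refine:
  fixes t :: "nat \<Rightarrow> 'b::ab_group_add \<Rightarrow> int"
  assumes fact: "positive_factorization G \<phi> J t e" and b: "0 \<le> \<phi> b"
  obtains m t' e' where "positive_factorization G \<phi> {..<m::nat} t' e'"
    "\<And>j. j < m \<Longrightarrow> 0 \<le> t' j b"
    "\<And>x j. (\<And>i. i \<in> J \<Longrightarrow> 0 \<le> t i x) \<Longrightarrow> j < m \<Longrightarrow> 0 \<le> t' j x"
proof -
  have fin: "finite J" and add: "\<And>j. j \<in> J \<Longrightarrow> additive (t j)"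
    and e: "\<And>j. j \<in> J \<Longrightarrow> e j \<in> G" "\<And>j. j \<in> J \<Longrightarrow> 0 \<le> e j"
    and \<phi>: "\<And>x. \<phi> x = (\<Sum>j\<in>J. int_mult (t j x) (e j))"
    using fact by (auto simp: positive_factorization_def)
  define I where "I = {j\<in>J. t j b < 0}"
  define P where "P = {j\<in>J. t j b > 0}"
  define Z where "Z = {j\<in>J. t j b = 0}"
  have fins: "finite I" "finite P" "finite Z" using fin by (auto simp: I_def P_def Z_def)
  have disj: "I \<inter> P = {}" "I \<inter> Z = {}" "P \<inter> Z = {}" by (auto simp: I_def P_def Z_def)
  have sub: "I \<subseteq> J" "P \<subseteq> J" "Z \<subseteq> J" by (auto simp: I_def P_def Z_def)
  have split: "sum h J = sum h I + sum h P + sum h Z" for h :: "nat \<Rightarrow> 'a"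
  proof -
    have J: "J = (I \<union> P) \<union> Z" by (auto simp: I_def P_def Z_def)
    have "sum h ((I \<union> P) \<union> Z) = sum h (I \<union> P) + sum h Z"
      using fins by (intro sum.union_disjoint) (auto simp: I_def P_def Z_def)
    also have "sum h (I \<union> P) = sum h I + sum h P"
      using fins by (intro sum.union_disjoint) (auto simp: I_def P_def)
    finally show ?thesis by (simp add: J)
  qed
  define M where "M = (\<Prod>j\<in>I \<union> P. \<bar>t j b\<bar>)"
  have M: "M > 0" unfolding M_def by (rule prod_pos) (auto simp: I_def P_def)
  \<comment> \<open>With pieces divided by \<open>M\<close>, each \<open>e j\<close> with
    \<open>j \<in> I \<union> P\<close> is \<open>w j\<close> times the sum of its pieces: cancel
    \<open>\<bar>t j b\<bar>\<close> using \<open>w j * \<bar>t j b\<bar> = M\<close>.\<close>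
  define w where "w j = M div \<bar>t j b\<bar>" for j
  have w: "w j * \<bar>t j b\<bar> = M" "0 < w j" if "j \<in> I \<union> P" for j
  proof -
    have "\<bar>t j b\<bar> dvd M"
      unfolding M_def using fins that by (intro dvd_prodI) auto
    then show 1: "w j * \<bar>t j b\<bar> = M" by (simp add: w_def)
    show "0 < w j" using 1 M by (metis abs_ge_zero less_eq_int_code(1) linorder_not_less mult_nonpos_nonneg)
  qed
  have wI: "- (w i * t i b) = M" if "i \<in> I" for i using w(1)[of i] that by (simp add: I_def)
  have wP: "w j * t j b = M" if "j \<in> P" for j using w(1)[of j] that by (simp add: P_def)
  have "\<phi> b = (\<Sum>j\<in>P. int_mult (t j b) (e j)) - (\<Sum>j\<in>I. int_mult \<bar>t j b\<bar> (e j))"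
  proof -
    have "(\<Sum>j\<in>Z. int_mult (t j b) (e j)) = 0"
      by (rule sum.neutral) (simp add: Z_def)
    moreover have "(\<Sum>j\<in>I. int_mult (t j b) (e j)) = - (\<Sum>j\<in>I. int_mult \<bar>t j b\<bar> (e j))"
      unfolding sum_negf[symmetric] by (rule sum.cong) (auto simp: I_def)
    ultimately show ?thesis using \<phi>[of b] by (simp add: split)
  qed
  then have "(\<Sum>j\<in>I. int_mult \<bar>t j b\<bar> (e j)) \<le> (\<Sum>j\<in>P. int_mult (t j b) (e j))"
    using b by simp
  then have "\<exists>c. (\<forall>i\<in>I. \<forall>j\<in>P. c i j \<in> G \<and> 0 \<le> c i j) \<and>
      (\<forall>i\<in>I. int_mult \<bar>t i b\<bar> (e i) = (\<Sum>j\<in>P. c i j)) \<and>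
      (\<forall>j\<in>P. (\<Sum>i\<in>I. c i j) \<le> int_mult (t j b) (e j))"
    using e sub by (intro riesz_refinement fins)
      (auto simp: P_def intro!: int_mult_mem int_mult_nonneg)
  then obtain c where c: "\<And>i j. i \<in> I \<Longrightarrow> j \<in> P \<Longrightarrow> c i j \<in> G \<and> 0 \<le> c i j"
    "\<And>i. i \<in> I \<Longrightarrow> int_mult \<bar>t i b\<bar> (e i) = (\<Sum>j\<in>P. c i j)"
    "\<And>j. j \<in> P \<Longrightarrow> (\<Sum>i\<in>I. c i j) \<le> int_mult (t j b) (e j)"
    by metis
  have "\<exists>y. y \<in> G \<and> 0 \<le> y \<and> int_mult M y = c i j" if "i \<in> I" "j \<in> P" for i j
    using divide_positive[of "c i j" M] c(1)[OF that] M by metis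
  then obtain c' where c': "\<And>i j. i \<in> I \<Longrightarrow> j \<in> P \<Longrightarrow> c' i j \<in> G \<and> 0 \<le> c' i j \<and> int_mult M (c' i j) = c i j"
    by metis
  have "\<exists>y. y \<in> G \<and> 0 \<le> y \<and> int_mult M y = int_mult (t j b) (e j) - (\<Sum>i\<in>I. c i j)" if "j \<in> P" for j
  proof -
    have "int_mult (t j b) (e j) - (\<Sum>i\<in>I. c i j) \<in> G"
      using that e c(1) by (intro diff_mem int_mult_mem sum_mem) (auto simp: P_def)
    then show ?thesis
      using divide_positive[of "int_mult (t j b) (e j) - (\<Sum>i\<in>I. c i j)" M] c(3)[OF that] M by (metis diff_ge_0_iff_ge)
  qed
  then obtain d where d: "\<And>j. j \<in> P \<Longrightarrow> d j \<in> G \<and> 0 \<le> d j \<and>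
      int_mult M (d j) = int_mult (t j b) (e j) - (\<Sum>i\<in>I. c i j)"
    by metis
  have eI: "e i = (\<Sum>j\<in>P. int_mult (w i) (c' i j))" if i: "i \<in> I" for i
  proof -
    have "int_mult \<bar>t i b\<bar> (\<Sum>j\<in>P. int_mult (w i) (c' i j)) = (\<Sum>j\<in>P. int_mult M (c' i j))"
      using w(1)[of i] i by (simp add: int_mult.scale_sum_right mult.commute)
    also have "\<dots> = int_mult \<bar>t i b\<bar> (e i)"
      using c(2)[OF i] c' i by simp
    finally have *: "int_mult \<bar>t i b\<bar> (e i) = int_mult \<bar>t i b\<bar> (\<Sum>j\<in>P. int_mult (w i) (c' i j))" by simp
    show ?thesis
      by (rule int_mult_cancel[OF subgroup unperf _ _ _ *])
        (use i e c' in \<open>auto simp: I_def intro!: sum_mem int_mult_mem\<close>)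
  qed
  have eP: "e j = (\<Sum>i\<in>I. int_mult (w j) (c' i j)) + int_mult (w j) (d j)" if j: "j \<in> P" for j
  proof -
    have "int_mult (t j b) ((\<Sum>i\<in>I. int_mult (w j) (c' i j)) + int_mult (w j) (d j)) =
        (\<Sum>i\<in>I. int_mult M (c' i j)) + int_mult M (d j)"
      using wP[OF j] by (simp add: int_mult.scale_right_distrib int_mult.scale_sum_right mult.commute)
    also have "\<dots> = int_mult (t j b) (e j)"
      using c' d j by simp
    finally have *: "int_mult (t j b) (e j) =
      int_mult (t j b) ((\<Sum>i\<in>I. int_mult (w j) (c' i j)) + int_mult (w j) (d j))" by simp
    show ?thesis
      by (rule int_mult_cancel[OF subgroup unperf _ _ _ *])
        (use j e c' d in \<open>auto simp: P_def intro!: add_mem sum_mem int_mult_mem\<close>)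
  qed
  \<comment> \<open>Pairs in \<open>I \<times> P\<close> index the pieces \<open>c' i j\<close>. The
    diagonal, disjoint from them, indexes the slacks \<open>d j\<close> for \<open>j \<in> P\<close>
    and the unchanged \<open>e j\<close> for \<open>j \<in> Z\<close>.\<close>
  define D where "D = (\<lambda>j. (j, j)) ` (P \<union> Z)"
  define L where "L = I \<times> P \<union> D"
  \<comment> \<open>The piece \<open>c' i j\<close> occurs \<open>w i\<close> times in
    \<open>e i\<close> and \<open>w j\<close> times in \<open>e j\<close>. At \<open>b\<close> its
    coefficient is \<open>- M + M = 0\<close>.\<close>
  define t' where "t' = (\<lambda>(i, j) x. if i \<in> I then w i * t i x + w j * t j x
     else if j \<in> P then w j * t j x else t j x)"
  define e' where "e' = (\<lambda>(i, j). if i \<in> I then c' i j else if j \<in> P then d j else e j)"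
  have t'_simps: "t' (i, j) x = w i * t i x + w j * t j x" if "i \<in> I" for i j x
    using that by (simp add: t'_def)
  have t'_P: "t' (j, j) x = w j * t j x" and e'_P: "e' (j, j) = d j" if "j \<in> P" for j x
    using that disj by (auto simp: t'_def e'_def)
  have t'_Z: "t' (j, j) x = t j x" and e'_Z: "e' (j, j) = e j" if "j \<in> Z" for j x
    using that disj by (auto simp: t'_def e'_def)
  have e'_simps: "e' (i, j) = c' i j" if "i \<in> I" for i j
    using that by (simp add: e'_def)
  note simps = t'_simps e'_simps t'_P e'_P t'_Z e'_Z
  have L_cases: "(\<exists>i\<in>I. \<exists>j\<in>P. l = (i, j)) \<or> (\<exists>j\<in>P. l = (j, j)) \<or> (\<exists>j\<in>Z. l = (j, j))"
    if "l \<in> L" for l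
    using that by (auto simp: L_def D_def)
  have "positive_factorization G \<phi> L t' e'"
    unfolding positive_factorization_def
  proof (intro conjI ballI allI)
    show "finite L" using fins by (simp add: L_def D_def)
  next
    fix l assume "l \<in> L"
    then show "additive (t' l)"
      using add sub by (auto simp: L_def D_def t'_def additive_def algebra_simps subset_iff)
  next
    fix l assume "l \<in> L"
    then show "e' l \<in> G" "0 \<le> e' l"
      using L_cases[of l] c' d e sub by (auto simp: simps)
  next
    fix x
    let ?s = "\<lambda>l. int_mult (t' l x) (e' l)"
    have "sum ?s L = sum ?s (I \<times> P) + sum ?s D"
      unfolding L_def using fins disj by (intro sum.union_disjoint) (auto simp: D_def)
    also have "sum ?s (I \<times> P) = (\<Sum>i\<in>I. \<Sum>j\<in>P. ?s (i, j))"
      by (simp add: sum.cartesian_product)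
    also have "\<dots> = (\<Sum>i\<in>I. \<Sum>j\<in>P. int_mult (t i x) (int_mult (w i) (c' i j))) +
        (\<Sum>i\<in>I. \<Sum>j\<in>P. int_mult (t j x) (int_mult (w j) (c' i j)))"
      by (simp add: simps int_mult.scale_left_distrib sum.distrib mult.commute)
    also have "(\<Sum>i\<in>I. \<Sum>j\<in>P. int_mult (t i x) (int_mult (w i) (c' i j))) =
        (\<Sum>i\<in>I. int_mult (t i x) (e i))"
      by (intro sum.cong refl) (subst eI, assumption, simp only: int_mult.scale_sum_right)
    also have "(\<Sum>i\<in>I. \<Sum>j\<in>P. int_mult (t j x) (int_mult (w j) (c' i j))) =
        (\<Sum>j\<in>P. \<Sum>i\<in>I. int_mult (t j x) (int_mult (w j) (c' i j)))"
      by (rule sum.swap)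
    also have "sum ?s D = (\<Sum>j\<in>P \<union> Z. ?s (j, j))"
      unfolding D_def by (subst sum.reindex) (auto simp: inj_on_def)
    also have "\<dots> = (\<Sum>j\<in>P. ?s (j, j)) + (\<Sum>j\<in>Z. ?s (j, j))"
      using fins disj by (intro sum.union_disjoint)
    also have "(\<Sum>j\<in>P. ?s (j, j)) = (\<Sum>j\<in>P. int_mult (t j x) (int_mult (w j) (d j)))"
      by (intro sum.cong) (simp_all add: simps mult.commute)
    also have "(\<Sum>j\<in>Z. ?s (j, j)) = (\<Sum>j\<in>Z. int_mult (t j x) (e j))"
      by (intro sum.cong) (simp_all add: simps)
    finally have s: "sum ?s L = (\<Sum>i\<in>I. int_mult (t i x) (e i))
      + ((\<Sum>j\<in>P. \<Sum>i\<in>I. int_mult (t j x) (int_mult (w j) (c' i j)))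
      + (\<Sum>j\<in>P. int_mult (t j x) (int_mult (w j) (d j)))) + (\<Sum>j\<in>Z. int_mult (t j x) (e j))"
      by (simp add: add.assoc)
    have "(\<Sum>j\<in>P. \<Sum>i\<in>I. int_mult (t j x) (int_mult (w j) (c' i j)))
      + (\<Sum>j\<in>P. int_mult (t j x) (int_mult (w j) (d j))) = (\<Sum>j\<in>P. int_mult (t j x) (e j))"
      unfolding sum.distrib[symmetric]
      by (intro sum.cong refl)
        (subst eP, assumption, simp only: int_mult.scale_sum_right int_mult.scale_right_distrib)
    then show "\<phi> x = sum ?s L"
      unfolding s \<phi> split by simp
  qed
  then obtain h where h: "bij_betw h {..<card L} L"
      "positive_factorization G \<phi> {..<card L} (t' \<circ> h) (e' \<circ> h)"
    by (rule positive_factorization_reindex)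
  have hL: "h j \<in> L" if "j < card L" for j
    using h(1) that by (auto simp: bij_betw_def)
  have "0 \<le> t' l b" if "l \<in> L" for l
  proof -
    have "t' (i, j) b = 0" if "i \<in> I" "j \<in> P" for i j
      using that wI[of i] wP[of j] by (simp add: simps)
    then show ?thesis
      using L_cases[OF that] wP M by (auto simp: simps) (auto simp: Z_def)
  qed
  \<comment> \<open>The new functionals are nonnegative combinations of the old ones, so
    nonnegativity gained earlier is kept.\<close>
  moreover have "0 \<le> t' l x" if "\<And>i. i \<in> J \<Longrightarrow> 0 \<le> t i x" "l \<in> L" for l x
    using L_cases[OF that(2)] that(1) sub w(2) by (auto simp: simps subset_iff less_imp_le)
  ultimately show thesis
    using that[OF h(2)] hL by simp
qed

section \<open>Shortening and minimal factorizations\<close>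

text \<open>With \<open>f\<close> the \<open>N\<close>-th part of \<open>e k\<close>, the summand of
  \<open>k\<close> equals the sum of the \<open>n j * t j x\<close> multiples of \<open>f\<close>,
  so adding \<open>int_mult (n j) f\<close> to each \<open>e j\<close> absorbs it.\<close>

lemma positive_factorization_remove:
  assumes fact: "positive_factorization G \<phi> J t e" and "k \<in> J" "0 < N"
    "\<And>j. j \<in> J - {k} \<Longrightarrow> 0 \<le> n j"
    "\<And>x. N * t k x = (\<Sum>j\<in>J - {k}. n j * t j x)"
  obtains e' where "positive_factorization G \<phi> (J - {k}) t e'"
proof -
  obtain f where f: "f \<in> G" "0 \<le> f" "int_mult N f = e k"
    using fact \<open>k \<in> J\<close> \<open>0 < N\<close> divide_positive[of "e k" N] by (auto simp: positive_factorization_def)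
  have "\<phi> x = (\<Sum>j\<in>J - {k}. int_mult (t j x) (e j + int_mult (n j) f))" for x
  proof -
    have "(\<Sum>j\<in>J - {k}. int_mult (t j x) (e j + int_mult (n j) f)) =
      (\<Sum>j\<in>J - {k}. int_mult (t j x) (e j)) + int_mult (\<Sum>j\<in>J - {k}. n j * t j x) f"
      by (simp add: int_mult.scale_right_distrib sum.distrib int_mult.scale_sum_left mult.commute)
    also have "int_mult (\<Sum>j\<in>J - {k}. n j * t j x) f = int_mult (t k x) (e k)"
      unfolding assms(5)[symmetric] f(3)[symmetric] by (simp add: mult.commute)
    also have "(\<Sum>j\<in>J - {k}. int_mult (t j x) (e j)) + int_mult (t k x) (e k) = \<phi> x"
      using fact \<open>k \<in> J\<close> sum.remove[of J k "\<lambda>j. int_mult (t j x) (e j)"]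
      by (simp add: positive_factorization_def add.commute)
    finally show ?thesis by simp
  qed
  then have "positive_factorization G \<phi> (J - {k}) t (\<lambda>j. e j + int_mult (n j) f)"
    using fact f assms(4)
    by (auto simp: positive_factorization_def intro!: add_mem int_mult_mem add_nonneg_nonneg int_mult_nonneg)
  with that show thesis .
qed

text \<open>Minimality of \<open>m\<close> forces the \<open>e\<^sub>j\<close> to be the positive basis of a simplicial subgroup.
  Suppose \<open>\<Sum> y\<^sub>j e\<^sub>j \<ge> 0\<close> with \<open>y\<^sub>k = -p < 0\<close>, and apply Farkas' lemma to \<open>t\<^sub>k\<close> and the
  functionals \<open>p t\<^sub>j + y\<^sub>j t\<^sub>k\<close>. If it yields \<open>x\<close> with \<open>D = -t\<^sub>k(x) > 0\<close>, then
  \<open>p \<phi>(x) - D \<Sum> y\<^sub>j e\<^sub>j \<ge> 0\<close>, so \<open>\<phi>(x) \<ge> 0\<close> although \<open>t\<^sub>k(x) < 0\<close>. If it yields a linear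
  dependence, one of the \<open>t\<^sub>j\<close> is redundant.\<close>
lemma positive_factorization_minimal:
  fixes t :: "nat \<Rightarrow> 'b::ab_group_add \<Rightarrow> int"
  assumes fact: "positive_factorization G \<phi> {..<m} t e"
    and pos: "\<And>x j. 0 \<le> \<phi> x \<Longrightarrow> j < m \<Longrightarrow> 0 \<le> t j x"
    and dir: "\<And>x. \<exists>u v. x = u - v \<and> 0 \<le> \<phi> u \<and> 0 \<le> \<phi> v"
    and min: "\<And>(t' :: nat \<Rightarrow> 'b \<Rightarrow> int) e' m'. positive_factorization G \<phi> {..<m'} t' e' \<Longrightarrow>
       (\<And>x j. 0 \<le> \<phi> x \<Longrightarrow> j < m' \<Longrightarrow> 0 \<le> t' j x) \<Longrightarrow> m \<le> m'"
    and y: "0 \<le> (\<Sum>j<m. int_mult (y j) (e j))" and k: "k < m"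
  shows "0 \<le> y k"
proof (rule ccontr)
  assume "\<not> 0 \<le> y k"
  define p where "p = - y k"
  have p: "p > 0" using \<open>\<not> 0 \<le> y k\<close> by (simp add: p_def)
  have add: "additive (t j)" if "j < m" for j
    using fact that by (simp add: positive_factorization_def)
  have e: "e j \<in> G" "0 \<le> e j" if "j < m" for j
    using fact that by (auto simp: positive_factorization_def)
  have \<phi>: "\<phi> x = (\<Sum>j<m. int_mult (t j x) (e j))" for x
    using fact by (simp add: positive_factorization_def)
  have irredundant: False if i: "i < m" "0 < N" "\<And>j. j \<in> {..<m} - {i} \<Longrightarrow> 0 \<le> n j"
    "\<And>x. N * t i x = (\<Sum>j\<in>{..<m} - {i}. n j * t j x)" for i N n
  proof -
    obtain e' where "positive_factorization G \<phi> ({..<m} - {i}) t e'"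
      by (rule positive_factorization_remove[OF fact, of i N n]) (use i in auto)
    then obtain h where h: "bij_betw h {..<card ({..<m} - {i})} ({..<m} - {i})"
      "positive_factorization G \<phi> {..<card ({..<m} - {i})} (t \<circ> h) (e' \<circ> h)"
      by (rule positive_factorization_reindex)
    have "h j < m" if "j < card ({..<m} - {i})" for j
      using h(1) that by (auto simp: bij_betw_def)
    then have "m \<le> card ({..<m} - {i})"
      using pos by (intro min[OF h(2)]) simp
    then show False using \<open>i < m\<close> by simp
  qed
  define J where "J = {..<m} - {k}"
  have J: "finite J" "{..<m} = insert k J" "k \<notin> J" "\<And>j. j \<in> J \<Longrightarrow> j < m"
    using k by (auto simp: J_def)
  have split: "sum g {..<m} = g k + sum g J" for g :: "nat \<Rightarrow> 'a"
    using J by simp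
  define \<tau> where "\<tau> j x = p * t j x + y j * t k x" for j x
  have farkas: "0 \<le> t k x" if x: "\<And>j. j \<in> J \<Longrightarrow> 0 \<le> \<tau> j x" for x
  proof (rule ccontr)
    assume neg: "\<not> 0 \<le> t k x"
    have "int_mult p (\<phi> x) + int_mult (t k x) (\<Sum>j<m. int_mult (y j) (e j)) =
        (\<Sum>j<m. int_mult (\<tau> j x) (e j))"
      by (simp add: \<phi> \<tau>_def int_mult.scale_sum_right int_mult.scale_left_distrib sum.distrib mult.commute)
    \<comment> \<open>The summand of \<open>k\<close> vanishes because
      \<open>y k = - p\<close>.\<close>
    also have "\<dots> = (\<Sum>j\<in>J. int_mult (\<tau> j x) (e j))"
      by (simp add: split \<tau>_def p_def)
    also have "\<dots> \<ge> 0"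
      using x e J by (intro sum_nonneg int_mult_nonneg) auto
    finally have 1: "0 \<le> int_mult p (\<phi> x) + int_mult (t k x) (\<Sum>j<m. int_mult (y j) (e j))" .
    have "0 \<le> int_mult (- t k x) (\<Sum>j<m. int_mult (y j) (e j))"
      using neg y by (intro int_mult_nonneg) auto
    from add_nonneg_nonneg[OF 1 this] have "0 \<le> int_mult p (\<phi> x)"
      by simp
    moreover have "\<phi> x \<in> G" using e by (auto simp: \<phi> intro!: sum_mem int_mult_mem)
    ultimately have "0 \<le> \<phi> x" using p int_mult_nonneg_cancel[OF unperf] by blast
    then show False using pos[of x k] k neg by simp
  qed
  have \<tau>: "additive (\<tau> j)" if "j \<in> J" for j
    using add[of j] add[of k] J k that by (auto simp: \<tau>_def additive_def algebra_simps)
  have "\<exists>N>0. \<exists>n. (\<forall>j\<in>J. 0 \<le> n j) \<and> (\<forall>x. N * t k x = (\<Sum>j\<in>J. n j * \<tau> j x))"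
    by (rule farkas_additive) (fact J(1), fact \<tau>, fact add[OF k], fact farkas)
  then obtain N n where N: "0 < N" "\<And>j. j \<in> J \<Longrightarrow> 0 \<le> n j"
      "\<And>x. N * t k x = (\<Sum>j\<in>J. n j * \<tau> j x)"
    by blast
  define c where "c = N - (\<Sum>j\<in>J. n j * y j)"
  have c: "c * t k x = (\<Sum>j\<in>J. (n j * p) * t j x)" for x
    using N(3)[of x]
    by (simp add: c_def \<tau>_def algebra_simps sum.distrib sum_distrib_left sum_distrib_right)
  show False
  proof (cases "c > 0")
    case True
    then show False
      using irredundant[of k c "\<lambda>j. n j * p"] k c N(2) p by (simp add: J_def)
  next
    case False
    have "\<exists>i\<in>J. n i \<noteq> 0"
    proof (rule ccontr)
      assume "\<not> ?thesis"
      then have "c = N" by (simp add: c_def)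
      with False N(1) show False by simp
    qed
    then obtain i where i: "i \<in> J" "n i > 0" using N(2) by force
    have zero: "t i x = 0" if x: "0 \<le> \<phi> x" for x
    proof -
      have "c * t k x \<le> 0" using False pos[OF x k] by (simp add: mult_nonpos_nonneg)
      moreover have nn: "0 \<le> (n j * p) * t j x" if "j \<in> J" for j
        using that N(2) p pos[OF x] J by simp
      ultimately have "(\<Sum>j\<in>J. (n j * p) * t j x) = 0"
        using c[of x] by (metis (no_types, lifting) sum_nonneg order.antisym)
      then have "(n i * p) * t i x = 0"
        using sum_nonneg_eq_0_iff[OF J(1), of "\<lambda>j. (n j * p) * t j x"] nn i by blast
      then show ?thesis using i p by simp
    qed
    have "t i x = 0" for x
      using dir[of x] zero add[of i] i J by (auto simp: additive.diff)
    then show False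
      using irredundant[of i 1 "\<lambda>_. 0"] i J by simp
  qed
qed

text \<open>One refinement per element of \<open>B\<close>; each keeps what the previous ones
  achieved.\<close>

lemma positive_factorization_refine_finite:
  fixes t :: "nat \<Rightarrow> 'b::ab_group_add \<Rightarrow> int"
  assumes "finite B" "\<And>b. b \<in> B \<Longrightarrow> 0 \<le> \<phi> b" "positive_factorization G \<phi> {..<m::nat} t e"
  shows "\<exists>m' t' e'. positive_factorization G \<phi> {..<m'::nat} t' e' \<and> (\<forall>b\<in>B. \<forall>j<m'. 0 \<le> t' j b)"
  using assms
proof (induction B rule: finite_induct)
  case empty
  then show ?case by blast
next
  case (insert b B)
  then obtain m' t' e' where 1: "positive_factorization G \<phi> {..<m'::nat} t' e'"
      "\<And>b j. b \<in> B \<Longrightarrow> j < m' \<Longrightarrow> 0 \<le> t' j b"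
    by (metis insertCI)
  have "0 \<le> \<phi> b" using insert.prems by blast
  from positive_factorization_refine[OF 1(1) this] obtain m'' t'' e''
    where 2: "positive_factorization G \<phi> {..<m''::nat} t'' e''" "\<And>j. j < m'' \<Longrightarrow> 0 \<le> t'' j b"
      "\<And>x j. (\<And>i. i \<in> {..<m'} \<Longrightarrow> 0 \<le> t' i x) \<Longrightarrow> j < m'' \<Longrightarrow> 0 \<le> t'' j x"
    by metis
  then have "\<forall>c\<in>insert b B. \<forall>j<m''. 0 \<le> t'' j c"
    using 1(2) by simp
  with 2(1) show ?case by blast
qed

section \<open>From coherent to E-ultrasimplicial\<close>

text \<open>Refining at the finitely many generators of the cone suffices, as additive functionals
  nonnegative on \<open>B\<close> are nonnegative on its hull. Directedness of \<open>H\<close>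
  makes every vector a difference of cone elements, as minimality requires.\<close>

lemma finitely_presented_subset_simplicial:
  assumes H: "ordered_subgroup H" "directed_group H" "H \<subseteq> G" "finitely_presented H"
  obtains W where "simplicial W" "finitely_generated_group W" "H \<subseteq> W" "W \<subseteq> G"
proof -
  obtain n g B where g: "H = group_closure (g ` {..<n})" and B: "finite B"
    "{x \<in> int_vectors n. 0 \<le> (\<Sum>i<n. int_mult (x i) (g i))} = submonoid hull B"
    using H(4) unfolding finitely_presented_def finitely_generated_submonoid_def by blast
  define \<phi> where "\<phi> x = (\<Sum>i<n. int_mult (x i) (g i))" for x :: "nat \<Rightarrow> int"
  have range: "H = range \<phi>"
    unfolding g group_closure_image_eq \<phi>_def ..
  have dir: "\<exists>u v. x = u - v \<and> 0 \<le> \<phi> u \<and> 0 \<le> \<phi> v" for x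
  proof -
    have "\<phi> x \<in> H" using range by blast
    then obtain a b where ab: "a \<in> H" "0 \<le> a" "b \<in> H" "0 \<le> b" "\<phi> x = a - b"
      using H(2) by (fastforce simp: directed_group_def positive_cone_def)
    then obtain v where v: "b = \<phi> v" using range by blast
    have "\<phi> (x + v) = a"
      using ab(5) v by (simp add: \<phi>_def int_mult.scale_left_distrib sum.distrib algebra_simps)
    with ab v show ?thesis
      by (intro exI[of _ "x + v"] exI[of _ v]) simp
  qed
  define good where "good m \<longleftrightarrow> (\<exists>t :: nat \<Rightarrow> (nat \<Rightarrow> int) \<Rightarrow> int. \<exists>e. positive_factorization G \<phi> {..<m} t e \<and>
    (\<forall>x. \<forall>j<m. 0 \<le> \<phi> x \<longrightarrow> 0 \<le> t j x))" for m
  have "\<exists>m. good m"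
  proof -
    have "\<exists>a b. a \<in> G \<and> 0 \<le> a \<and> b \<in> G \<and> 0 \<le> b \<and> g i = a - b" if "i < n" for i
    proof -
      have "g i \<in> G" using that H(3) g by (blast intro: group_closure.base)
      then show ?thesis
        using directed by (fastforce simp: directed_group_def positive_cone_def)
    qed
    then obtain a b where ab: "\<And>i. i < n \<Longrightarrow> a i \<in> G \<and> 0 \<le> a i \<and> b i \<in> G \<and> 0 \<le> b i \<and> g i = a i - b i"
      by metis
    \<comment> \<open>The initial factorization writes \<open>g i = a i - b i\<close> and uses the
      coefficients \<open>x i\<close> and \<open>- x i\<close>.\<close>
    define e0 where "e0 = (\<lambda>(s, i). if s then a i else b i)"
    define t0 :: "bool \<times> nat \<Rightarrow> (nat \<Rightarrow> int) \<Rightarrow> int" where "t0 = (\<lambda>(s, i) x. if s then x i else - x i)"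
    have "positive_factorization G \<phi> (UNIV \<times> {..<n}) t0 e0"
      unfolding positive_factorization_def
    proof (intro conjI ballI allI)
      fix x
      have "(\<Sum>l\<in>UNIV \<times> {..<n}. int_mult (t0 l x) (e0 l)) =
          (\<Sum>s\<in>UNIV. \<Sum>i<n. int_mult (t0 (s, i) x) (e0 (s, i)))"
        by (simp add: sum.cartesian_product)
      also have "\<dots> = (\<Sum>i<n. int_mult (x i) (a i)) + (\<Sum>i<n. int_mult (- x i) (b i))"
        by (simp add: UNIV_bool t0_def e0_def)
      also have "\<dots> = \<phi> x"
        unfolding \<phi>_def sum.distrib[symmetric]
        using ab by (intro sum.cong) (auto simp: int_mult.scale_right_diff_distrib)
      finally show "\<phi> x = (\<Sum>l\<in>UNIV \<times> {..<n}. int_mult (t0 l x) (e0 l))" by simp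
    qed (use ab in \<open>auto simp: t0_def e0_def additive_def\<close>)
    then obtain h where
      "positive_factorization G \<phi> {..<card (UNIV \<times> {..<n} :: (bool \<times> nat) set)} (t0 \<circ> h) (e0 \<circ> h)"
      by (rule positive_factorization_reindex)
    moreover have "0 \<le> \<phi> b" if "b \<in> B" for b
      using hull_inc[OF that, of submonoid] B(2) unfolding \<phi>_def by blast
    ultimately obtain m t e where fact: "positive_factorization G \<phi> {..<m::nat} t e"
      and t: "\<And>b j. b \<in> B \<Longrightarrow> j < m \<Longrightarrow> 0 \<le> t j b"
      using positive_factorization_refine_finite[OF B(1)] by metis
    have add: "additive (t j)" if "j < m" for j
      using fact that by (simp add: positive_factorization_def)
    \<comment> \<open>\<open>\<phi>\<close> is defined on all sequences, while \<open>B\<close>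
      generates only cone vectors supported below \<open>n\<close>. Truncation by
      \<open>\<rho>\<close> carries positivity over to every \<open>x\<close> with
      \<open>0 \<le> \<phi> x\<close>.\<close>
    define \<rho> where "\<rho> x i = (if i < n then x i else 0)" for x :: "nat \<Rightarrow> int" and i
    have \<phi>\<rho>: "\<phi> (\<rho> x) = \<phi> x" for x
      by (simp add: \<phi>_def \<rho>_def)
    have \<rho>_add: "\<rho> (x + y) = \<rho> x + \<rho> y" for x y
      by (auto simp: \<rho>_def)
    have "positive_factorization G \<phi> {..<m} (\<lambda>j. t j \<circ> \<rho>) e"
      using fact \<phi>\<rho> by (auto simp: positive_factorization_def additive_def \<rho>_add)
    moreover have "0 \<le> t j (\<rho> x)" if "0 \<le> \<phi> x" "j < m" for x j
    proof -
      have "\<rho> x \<in> submonoid hull B"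
        unfolding B(2)[symmetric] using that \<phi>\<rho>[of x] by (auto simp: \<rho>_def \<phi>_def int_vectors_def)
      then show ?thesis
        by (rule hull_induct)
          (use t that add in \<open>auto simp: submonoid_def additive.add additive.zero\<close>)
    qed
    ultimately show ?thesis unfolding good_def by (metis comp_apply)
  qed
  then have "good (LEAST m. good m)" by (rule LeastI_ex)
  moreover define m where "m = (LEAST m. good m)"
  ultimately obtain t :: "nat \<Rightarrow> (nat \<Rightarrow> int) \<Rightarrow> int" and e
    where fact: "positive_factorization G \<phi> {..<m} t e"
      and pos: "\<And>x j. 0 \<le> \<phi> x \<Longrightarrow> j < m \<Longrightarrow> 0 \<le> t j x"
    unfolding good_def by blast
  have min: "m \<le> m'" if "positive_factorization G \<phi> {..<m'} t' e'"
       "\<And>x j. 0 \<le> \<phi> x \<Longrightarrow> j < m' \<Longrightarrow> 0 \<le> t' j x" for t' :: "nat \<Rightarrow> (nat \<Rightarrow> int) \<Rightarrow> int" and e' m'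
    unfolding m_def using that by (intro Least_le) (auto simp: good_def)
  have "simplicial (group_closure (e ` {..<m}))"
  proof (rule simplicial_group_closure)
    show "0 \<le> e j" if "j < m" for j
      using fact that by (simp add: positive_factorization_def)
    show "0 \<le> y j" if y: "0 \<le> (\<Sum>i<m. int_mult (y i) (e i))" and j: "j < m" for y j
      by (rule positive_factorization_minimal[OF fact]) (fact pos dir min y j)+
  qed
  moreover have "H \<subseteq> group_closure (e ` {..<m})"
    unfolding range group_closure_image_eq using fact by (auto simp: positive_factorization_def)
  moreover have "group_closure (e ` {..<m}) \<subseteq> G"
    using fact by (intro group_closure_least subgroup) (auto simp: positive_factorization_def)
  moreover have "finitely_generated_group (group_closure (e ` {..<m}))"
    unfolding finitely_generated_group_def by blast
  ultimately show thesis using that by blast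
qed

text \<open>Splitting each \<open>s\<close> into a difference of positive elements and generating
  \<open>H\<close> by these makes \<open>H\<close> directed.\<close>

lemma coherent_imp_finite_subset_simplicial:
  assumes "coherent G" "finite S" "S \<subseteq> G"
  obtains W where "simplicial W" "finitely_generated_group W" "S \<subseteq> W" "W \<subseteq> G"
proof -
  have "\<exists>a b. a \<in> G \<and> 0 \<le> a \<and> b \<in> G \<and> 0 \<le> b \<and> s = a - b" if "s \<in> S" for s
    using that assms(3) directed by (fastforce simp: directed_group_def positive_cone_def)
  then obtain a b where ab: "\<And>s. s \<in> S \<Longrightarrow> a s \<in> G \<and> 0 \<le> a s \<and> b s \<in> G \<and> 0 \<le> b s"
    and diff: "\<And>s. s \<in> S \<Longrightarrow> a s - b s = s"
    by metis
  define H where "H = group_closure (a ` S \<union> b ` S)"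
  have H: "ordered_subgroup H"
    unfolding H_def by (rule ordered_subgroup_group_closure)
  have "H \<subseteq> G"
    unfolding H_def using ab by (intro group_closure_least subgroup) blast
  moreover have "finitely_generated_group H"
    unfolding finitely_generated_group_def H_def
    by (intro exI[of _ "a ` S \<union> b ` S"]) (simp add: assms(2))
  ultimately have "finitely_presented H"
    using assms(1) H by (simp add: coherent_def)
  moreover have "directed_group H"
    unfolding directed_group_def
  proof
    fix x assume "x \<in> H"
    then have "\<exists>u v. u \<in> H \<and> 0 \<le> u \<and> v \<in> H \<and> 0 \<le> v \<and> x = u - v"
      unfolding H_def
    proof induction
      case (base s)
      then have "s \<in> group_closure (a ` S \<union> b ` S)" "0 \<le> s"
        using ab by (auto intro: group_closure.base)
      then show ?case by (intro exI[of _ s] exI[of _ 0]) simp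
    next
      case (diff x y)
      then obtain u v u' v' where *: "u \<in> H" "0 \<le> u" "v \<in> H" "0 \<le> v" "x = u - v"
        "u' \<in> H" "0 \<le> u'" "v' \<in> H" "0 \<le> v'" "y = u' - v'"
        unfolding H_def by blast
      then show ?case
        unfolding H_def[symmetric]
        by (intro exI[of _ "u + v'"] exI[of _ "v + u'"])
          (auto intro: ordered_subgroup_add[OF H])
    qed
    then show "\<exists>a\<in>positive_cone H. \<exists>b\<in>positive_cone H. x = a + - b"
      by (auto simp: positive_cone_def)
  qed
  ultimately obtain W where W: "simplicial W" "finitely_generated_group W" "H \<subseteq> W" "W \<subseteq> G"
    using finitely_presented_subset_simplicial[OF H] \<open>H \<subseteq> G\<close> by metis
  have "S \<subseteq> H"
  proof
    fix s assume "s \<in> S"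
    then have "a s - b s \<in> H"
      unfolding H_def by (auto intro: group_closure.diff group_closure.base)
    with \<open>s \<in> S\<close> show "s \<in> H" using diff by simp
  qed
  with W that show thesis by blast
qed

lemma coherent_imp_E_ultrasimplicial:
  assumes "coherent G"
  shows "E_ultrasimplicial G"
proof -
  \<comment> \<open>Finite generation is included so that two members have an upper bound:
    \<open>ex\<close> is applied to the union of their generating sets.\<close>
  define \<H> where "\<H> = {W. simplicial W \<and> finitely_generated_group W \<and> W \<subseteq> G}"
  have ex: "\<exists>W\<in>\<H>. S \<subseteq> W" if S: "finite S" "S \<subseteq> G" for S
    by (rule coherent_imp_finite_subset_simplicial[OF assms S]) (auto simp: \<H>_def)
  have "\<H> \<noteq> {}" using ex[of "{}"] by auto
  moreover have "\<forall>W\<in>\<H>. simplicial W" by (simp add: \<H>_def)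
  moreover have "\<exists>L\<in>\<H>. W \<subseteq> L \<and> W' \<subseteq> L" if W: "W \<in> \<H>" "W' \<in> \<H>" for W W'
  proof -
    obtain S S' where S: "finite S" "W = group_closure S" "finite S'" "W' = group_closure S'"
      using W unfolding \<H>_def finitely_generated_group_def by auto
    have "S \<subseteq> W" "S' \<subseteq> W'" unfolding S by (auto intro: group_closure.base)
    then have "S \<union> S' \<subseteq> G" using W by (auto simp: \<H>_def)
    then obtain L where L: "L \<in> \<H>" "S \<union> S' \<subseteq> L" using ex[of "S \<union> S'"] S(1,3) by auto
    then have sub: "ordered_subgroup L" by (simp add: \<H>_def simplicial_def)
    have "W \<subseteq> L" "W' \<subseteq> L"
      using group_closure_least[OF sub, of S] group_closure_least[OF sub, of S'] L(2)
      by (simp_all add: S(2,4))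
    with L(1) show ?thesis by blast
  qed
  moreover have "G = \<Union>\<H>"
  proof
    show "G \<subseteq> \<Union>\<H>"
    proof
      fix x assume "x \<in> G"
      then show "x \<in> \<Union>\<H>" using ex[of "{x}"] by auto
    qed
    show "\<Union>\<H> \<subseteq> G" by (auto simp: \<H>_def)
  qed
  ultimately show ?thesis
    unfolding E_ultrasimplicial_def by (intro exI[of _ \<H>] conjI ballI) auto
qed

end

theorem theorem3:
  fixes G :: "'a::ordered_ab_group_add set"
  assumes "dimension_group G" and "divisible_group G"
  shows "E_ultrasimplicial G \<longleftrightarrow> coherent G"
proof -
  interpret divisible_dimension_group G
    using assms by unfold_locales
  show ?thesis
    using E_ultrasimplicial_imp_coherent coherent_imp_E_ultrasimplicial by blast
qed

end
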